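(* Let $\Sigma_2=\{x,y\}$. The collection $$\Phi_2=\{\,xx,\ x x^R,\ xyx\cdot yxy,\ xy\cdot yx\cdot x^R\cdot y^R,\ xy\cdot y x^R\cdot y^R,\ xy\cdot y^R x^R,\ xyx\cdot y^R\,\}$$ is a $2$-avoidance basis for formulas with reversal (over $\Sigma_2$).
   Context: For a set $\Sigma$ of variables let $\Sigma^R=\{x^R: x\in\Sigma\}$ be a disjoint copy, with $(x^R)^R=x$. A pattern with reversal over $\Sigma$ is a finite word over $\Sigma\cup\Sigma^R$; a formula with reversal over $\Sigma$ is a finite set of such patterns, called its fragments, and the set $\{p_1,\dots,p_n\}$ is written $p_1\cdot p_2\cdot\ldots\cdot p_n$. A pattern is a factor of a formula if it is a factor (contiguous subword) of some fragment of it. Avoidability: for an alphabet $A$, a morphism $f:(\Sigma\cup\Sigma^R)^*\to A^*$ respects reversal if $f(x^R)$ is the reversal (mirror image) of the word $f(x)$ for every $x\in\Sigma$. A formula with reversal $\phi$ occurs in a word $w$ if there is a non-erasing morphism $f$ respecting reversal such that $f(p)$ is a factor of $w$ for every fragment $p$ of $\phi$; otherwise $w$ avoids $\phi$. $\phi$ is $k$-avoidable if infinitely many words over a $k$-letter alphabet avoid $\phi$, and avoidable if it is $k$-avoidable for some $k$; otherwise it is unavoidable. e-division: a morphism $h:(\Sigma\cup\Sigma^R)^*\to(\Sigma\cup\Sigma^R)^*$ respects d-reversal if for all $x\in\Sigma$, writing $h(x)=a_1a_2\cdots a_m$ with $a_i\in\Sigma\cup\Sigma^R$, one has $h(x^R)=a_m^R\cdots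 a_2^Ra_1^R$. $\phi$ e-divides $\psi$ if there is an injective morphism $h$ respecting d-reversal with $|h(x)|=1$ for all $x\in\Sigma\cup\Sigma^R$ such that $h(p)$ is a factor of $\psi$ for every fragment $p$ of $\phi$. $n$-avoidance basis: for an alphabet $\Sigma_n$ of $n$ variables, a set $\Phi$ of avoidable formulas with reversal over $\Sigma_n$ is an $n$-avoidance basis for formulas with reversal if (i) for every avoidable formula with reversal $\psi$ over $\Sigma_n$ there is some $\phi\in\Phi$ that e-divides $\psi$, and (ii) for all $\phi_1,\phi_2\in\Phi$, if $\phi_1$ e-divides $\phi_2$ then $\phi_1=\phi_2$. *)

theory Defs
  imports Main "HOL-Library.Sublist"
begin

text \<open>
  The variable set \<open>\<Sigma>\<close> is a type \<open>'v\<close>; the disjoint union of \<open>\<Sigma>\<close> and \<open>\<Sigma>\<^sup>R\<close> is the type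
  \<open>'v letter\<close>, with \<open>Rev x\<close> standing for \<open>x\<^sup>R\<close>.
\<close>

datatype 'v letter = Var 'v | Rev 'v

fun mirror :: "'v letter \<Rightarrow> 'v letter" where
  "mirror (Var x) = Rev x"
| "mirror (Rev x) = Var x"

type_synonym 'v pattern = "'v letter list"

text \<open>A formula is a \<^emph>\<open>finite\<close> set of patterns; finiteness is imposed by \<open>formula\<close>.\<close>

type_synonym 'v fragments = "'v pattern set"

definition formula :: "'v fragments \<Rightarrow> bool" where
  "formula \<phi> \<longleftrightarrow> finite \<phi>"

text \<open>\<open>sublist\<close> is the library's contiguous factor relation.\<close>

definition factor_of :: "'v pattern \<Rightarrow> 'v fragments \<Rightarrow> bool" where
  "factor_of p \<phi> \<longleftrightarrow> (\<exists>q\<in>\<phi>. sublist p q)"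

definition morphism :: "('a list \<Rightarrow> 'b list) \<Rightarrow> bool" where
  "morphism f \<longleftrightarrow> (\<forall>u v. f (u @ v) = f u @ f v)"

definition non_erasing :: "('a list \<Rightarrow> 'b list) \<Rightarrow> bool" where
  "non_erasing f \<longleftrightarrow> (\<forall>u. u \<noteq> [] \<longrightarrow> f u \<noteq> [])"

definition respects_reversal :: "('v pattern \<Rightarrow> 'a list) \<Rightarrow> bool" where
  "respects_reversal f \<longleftrightarrow> (\<forall>x. f [Rev x] = rev (f [Var x]))"

definition occurs_in :: "'a set \<Rightarrow> 'v fragments \<Rightarrow> 'a list \<Rightarrow> bool" where
  "occurs_in A \<phi> w \<longleftrightarrow>
     (\<exists>f. morphism f \<and> range f \<subseteq> lists A \<and> non_erasing f \<and> respects_reversal f \<and>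
          (\<forall>p\<in>\<phi>. sublist (f p) w))"

text \<open>The \<open>k\<close>-letter alphabet is taken to be \<open>{0, \<dots>, k - 1}\<close>.\<close>

definition k_avoidable :: "nat \<Rightarrow> 'v fragments \<Rightarrow> bool" where
  "k_avoidable k \<phi> \<longleftrightarrow> infinite {w \<in> lists {..<k}. \<not> occurs_in {..<k} \<phi> w}"

definition avoidable :: "'v fragments \<Rightarrow> bool" where
  "avoidable \<phi> \<longleftrightarrow> (\<exists>k. k_avoidable k \<phi>)"

definition respects_d_reversal :: "('v pattern \<Rightarrow> 'v pattern) \<Rightarrow> bool" where
  "respects_d_reversal h \<longleftrightarrow> (\<forall>x. h [Rev x] = rev (map mirror (h [Var x])))"

definition e_divides :: "'v fragments \<Rightarrow> 'v fragments \<Rightarrow> bool" where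
  "e_divides \<phi> \<psi> \<longleftrightarrow>
     (\<exists>h. morphism h \<and> inj h \<and> respects_d_reversal h \<and> (\<forall>a. length (h [a]) = 1) \<and>
          (\<forall>p\<in>\<phi>. factor_of (h p) \<psi>))"

definition avoidance_basis :: "nat \<Rightarrow> 'v fragments set \<Rightarrow> bool" where
  "avoidance_basis n \<Phi> \<longleftrightarrow>
     finite (UNIV :: 'v set) \<and> card (UNIV :: 'v set) = n \<and>
     (\<forall>\<phi>\<in>\<Phi>. formula \<phi> \<and> avoidable \<phi>) \<and>
     (\<forall>\<psi>. formula \<psi> \<and> avoidable \<psi> \<longrightarrow> (\<exists>\<phi>\<in>\<Phi>. e_divides \<phi> \<psi>)) \<and>
     (\<forall>\<phi>\<^sub>1\<in>\<Phi>. \<forall>\<phi>\<^sub>2\<in>\<Phi>. e_divides \<phi>\<^sub>1 \<phi>\<^sub>2 \<longrightarrow> \<phi>\<^sub>1 = \<phi>\<^sub>2)"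

text \<open>The two-variable alphabet \<open>\<Sigma>\<^sub>2\<close>.\<close>

datatype var2 = X | Y

end

theory Submission
  imports Defs
begin

text \<open>
  All seven formulas are avoided by one infinite word, a coloured Toeplitz word: the letter at
  position \<open>n > 0\<close> records \<open>n mod 12\<close> and the odd part of \<open>n\<close> modulo 8. The residue modulo 3
  prevents a factor \<open>cd\<close> and its mirror image \<open>dc\<close> from both occurring, and halving a
  hypothetical period gives an infinite descent which excludes factors \<open>uvu\<close> with
  \<open>|v| \<le> |u|\<close>. Conversely, a formula over two variables that is not divided by any of the
  seven has only factors of \<open>xyx\<close> as fragments, where \<open>y\<close> carries a fixed sign, or only
  factors of \<open>xy\<close>, the remaining signs being arbitrary. Sending the variables of arbitrary
  sign to single letters, which are palindromes, makes these formulas occur in every long word.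
\<close>

section \<open>Morphisms\<close>

lemma mirror_mirror [simp]: "mirror (mirror a) = a"
  by (cases a) auto

lemma mirror_neq [simp]: "mirror a \<noteq> a" "a \<noteq> mirror a"
  by (cases a; simp)+

lemma mirror_eq_iff: "mirror a = b \<longleftrightarrow> a = mirror b"
  by auto

lemma morphism_Nil: "morphism f \<Longrightarrow> f [] = []"
  by (metis append.right_neutral append_self_conv morphism_def)

lemma morphism_Cons: "morphism f \<Longrightarrow> f (a # p) = f [a] @ f p"
  by (metis append_Cons append_Nil morphism_def)

lemma morphism_concat_map: "morphism (\<lambda>p. concat (map g p))"
  by (simp add: morphism_def)

lemma non_erasing_concat_map:
  assumes "\<And>a. g a \<noteq> []"
  shows "non_erasing (\<lambda>p. concat (map g p))"
  using assms by (auto simp: non_erasing_def neq_Nil_conv)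

lemma sublist_concat_map:
  assumes "sublist p q"
  shows "sublist (concat (map g p)) (concat (map g q))"
proof -
  obtain ps ss where "q = ps @ p @ ss" using assms by (auto simp: sublist_def)
  then show ?thesis by simp
qed

section \<open>An infinite word avoiding all seven formulas\<close>

function odd_part :: "nat \<Rightarrow> nat" where
  "odd_part n = (if even n \<and> n > 0 then odd_part (n div 2) else n)"
  by auto
termination by (relation "measure id") auto

declare odd_part.simps [simp del]

lemma odd_part_odd: "odd n \<Longrightarrow> odd_part n = n"
  by (subst odd_part.simps) simp

lemma odd_part_double: "n > 0 \<Longrightarrow> odd_part (2 * n) = odd_part n"
  by (subst odd_part.simps) simp

text \<open>Infinite descent on the period. At an odd position the odd part is the position itself,
  so agreement there forces \<open>8 dvd p\<close>; the even positions then show, after halving, the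
  same agreement with period \<open>p div 2\<close>, again a multiple of 4.\<close>

lemma odd_part_repetition:
  assumes "a > 0" "p > 0" "4 dvd p" "p \<le> 2 * l"
    and "\<And>i. a \<le> i \<Longrightarrow> i < a + l \<Longrightarrow> odd_part i mod 8 = odd_part (i + p) mod 8"
  shows False
  using assms
proof (induction p arbitrary: a l rule: less_induct)
  case (less p)
  have "p \<ge> 4" using less.prems by (auto elim: dvdE)
  then have "l \<ge> 2" using less.prems by simp
  \<comment> \<open>As \<open>l \<ge> 2\<close>, the window contains an odd position;
    \<open>i\<close> is the first one.\<close>
  define i where "i = (if odd a then a else a + 1)"
  have i: "odd i" "a \<le> i" "i < a + l" using \<open>l \<ge> 2\<close> by (auto simp: i_def)
  have "odd (i + p)" using i \<open>4 dvd p\<close> by (auto elim: dvdE)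
  then have "i mod 8 = (i + p) mod 8"
    using less.prems(5)[of i] i by (simp add: odd_part_odd)
  then have "8 dvd p" by (metis add_diff_cancel_left' mod_eq_dvd_iff_nat le_add1)
  then obtain t where t: "p = 8 * t" by (elim dvdE)
  show False
  \<comment> \<open>The even positions of the window are halved. Rounding \<open>l div 2\<close>
    down is harmless: \<open>p = 8 * t\<close> gives \<open>4 * t \<le> l\<close>, hence
    \<open>p div 2 \<le> 2 * (l div 2)\<close>.\<close>
  proof (rule less.IH[of "p div 2" "(a + 1) div 2" "l div 2"])
    fix j assume j: "(a + 1) div 2 \<le> j" "j < (a + 1) div 2 + l div 2"
    then have "a \<le> 2 * j" "2 * j < a + l" "j > 0" using \<open>a > 0\<close> by linarith+
    moreover have "2 * j + p = 2 * (j + p div 2)" using t by simp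
    ultimately show "odd_part j mod 8 = odd_part (j + p div 2) mod 8"
      using less.prems(5)[of "2 * j"] by (metis odd_part_double add_gr_0)
  qed (use t less.prems in auto)
qed

text \<open>A pair of residues coded as one number. The modulus 12 serves twice: its factor 3
  detects the reading direction, its factor 4 starts the descent of
  \<open>odd_part_repetition\<close>.\<close>

definition toeplitz :: "nat \<Rightarrow> nat" where
  "toeplitz n = n mod 12 + 12 * (odd_part n mod 8)"

lemma toeplitz_less: "toeplitz n < 96"
proof -
  have "n mod 12 < 12" "odd_part n mod 8 < 8" by simp_all
  then show ?thesis unfolding toeplitz_def by linarith
qed

lemma toeplitz_eqD:
  assumes "toeplitz m = toeplitz n"
  shows "m mod 12 = n mod 12" "odd_part m mod 8 = odd_part n mod 8"
proof -
  have *: "toeplitz k mod 12 = k mod 12" "toeplitz k div 12 = odd_part k mod 8" for k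
    by (simp_all add: toeplitz_def)
  show "m mod 12 = n mod 12" "odd_part m mod 8 = odd_part n mod 8"
    using assms *[of m] *[of n] by simp_all
qed

text \<open>Prefixes of one infinite word. It starts at position 1 because 0 has no genuine odd
  part.\<close>

definition toeplitz_word :: "nat \<Rightarrow> nat list" where
  "toeplitz_word n = map toeplitz [1..<Suc n]"

lemma sublist_toeplitz_word:
  assumes "sublist v (toeplitz_word n)"
  obtains a where "a > 0" "\<And>i. i < length v \<Longrightarrow> v ! i = toeplitz (a + i)"
proof -
  obtain ps ss where w: "toeplitz_word n = ps @ v @ ss"
    using assms by (auto simp: sublist_def)
  have len: "length ps + length v \<le> n"
    using arg_cong[OF w, of length] by (simp add: toeplitz_word_def del: upt_Suc)
  have "v ! i = toeplitz (Suc (length ps) + i)" if "i < length v" for i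
  proof -
    have "v ! i = toeplitz_word n ! (length ps + i)"
      using that by (simp add: w nth_append)
    also have "\<dots> = toeplitz (Suc (length ps) + i)"
      using that len by (simp add: toeplitz_word_def nth_upt del: upt_Suc)
    finally show ?thesis .
  qed
  then show ?thesis using that by blast
qed

section \<open>Mirror images and repetitions in the Toeplitz word\<close>

lemma sublist_toeplitz_pair:
  assumes "sublist [c, d] (toeplitz_word n)"
  obtains a where "c = toeplitz a" "d = toeplitz (Suc a)"
proof -
  obtain a where "\<And>i. i < length [c, d] \<Longrightarrow> [c, d] ! i = toeplitz (a + i)"
    using sublist_toeplitz_word[OF assms] by blast
  from this[of 0] this[of 1] show ?thesis by (intro that[of a]) simp_all
qed

text \<open>Modulo 3 the position grows by 1 from \<open>c\<close> to \<open>d\<close> and again by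
  1 from \<open>d\<close> to \<open>c\<close>, so 2 would be 0 modulo 3. The letters may coincide,
  so doubled letters are excluded too.\<close>

lemma toeplitz_word_mirror_pair:
  assumes "sublist [c, d] (toeplitz_word n)" "sublist [d, c] (toeplitz_word n)"
  shows False
proof -
  obtain a where a: "c = toeplitz a" "d = toeplitz (Suc a)"
    using assms(1) by (rule sublist_toeplitz_pair)
  obtain b where b: "d = toeplitz b" "c = toeplitz (Suc b)"
    using assms(2) by (rule sublist_toeplitz_pair)
  have "a mod 12 = Suc b mod 12" "Suc a mod 12 = b mod 12"
    using a b toeplitz_eqD(1)[of a "Suc b"] toeplitz_eqD(1)[of "Suc a" b] by simp_all
  then have "a mod 12 mod 3 = Suc b mod 12 mod 3" "Suc a mod 12 mod 3 = b mod 12 mod 3"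
    by simp_all
  then have "a mod 3 = Suc b mod 3" "Suc a mod 3 = b mod 3"
    by (simp_all add: mod_mod_cancel)
  then show False by presburger
qed

lemma toeplitz_word_mirror:
  assumes "sublist v (toeplitz_word n)" "sublist (rev v) (toeplitz_word n)"
  shows "length v \<le> 1"
proof (rule ccontr)
  assume "\<not> length v \<le> 1"
  then obtain c d r where v: "v = c # d # r"
    by (cases v; cases "tl v") auto
  have "sublist [c, d] v" "sublist [d, c] (rev v)"
    by (simp_all add: v)
  then show False
    using assms toeplitz_word_mirror_pair sublist_order.order_trans by blast
qed

text \<open>The two copies of \<open>u\<close> are at distance \<open>length u + length v\<close>,
  and the bound on \<open>v\<close> makes this at most \<open>2 * length u\<close>, as the descent
  requires.\<close>

lemma toeplitz_word_repetition:
  assumes "sublist (u @ v @ u) (toeplitz_word n)" "u \<noteq> []" "length v \<le> length u"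
  shows False
proof -
  define p where "p = length u + length v"
  obtain a where a: "a > 0"
    "\<And>i. i < length (u @ v @ u) \<Longrightarrow> (u @ v @ u) ! i = toeplitz (a + i)"
    using sublist_toeplitz_word[OF assms(1)] by blast
  have eq: "toeplitz (a + i) = toeplitz (a + i + p)" if "i < length u" for i
  proof -
    have "(u @ v @ u) ! i = (u @ v @ u) ! (i + p)"
      using that by (simp add: nth_append p_def)
    then show ?thesis using a(2)[of i] a(2)[of "i + p"] that by (simp add: p_def add.assoc)
  qed
  \<comment> \<open>The first letters of the two copies already force
    \<open>12 dvd p\<close>.\<close>
  have "a mod 12 = (a + p) mod 12"
    using toeplitz_eqD(1)[OF eq[of 0]] assms(2) by simp
  then have "12 dvd p" by (metis add_diff_cancel_left' mod_eq_dvd_iff_nat le_add1)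
  then have "4 dvd p" by (rule dvd_trans[rotated]) simp
  moreover have "p > 0" using assms(2) by (simp add: p_def)
  moreover have "odd_part i mod 8 = odd_part (i + p) mod 8" if "a \<le> i" "i < a + length u" for i
    using toeplitz_eqD(2)[OF eq[of "i - a"]] that by simp
  ultimately show False
    using odd_part_repetition[of a p "length u"] \<open>a > 0\<close> assms(3) by (simp add: p_def)
qed

text \<open>The prefixes have pairwise different lengths, so they supply infinitely many avoiding
  words over 96 letters.\<close>

lemma avoidable_if_toeplitz_word_avoids:
  fixes \<phi> :: "'v fragments"
  assumes "\<And>f n. morphism f \<Longrightarrow> non_erasing f \<Longrightarrow> respects_reversal f \<Longrightarrow>
      \<forall>p\<in>\<phi>. sublist (f p) (toeplitz_word n) \<Longrightarrow> False"
  shows "avoidable \<phi>"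
proof -
  have "inj toeplitz_word"
    by (rule inj_on_inverseI[where g = length]) (simp add: toeplitz_word_def)
  then have "infinite (range toeplitz_word)" by (simp add: finite_image_iff)
  moreover have "range toeplitz_word \<subseteq> {w \<in> lists {..<96}. \<not> occurs_in {..<96} \<phi> w}"
  proof
    fix w assume "w \<in> range toeplitz_word"
    then obtain n where "w = toeplitz_word n" by blast
    moreover from this have "w \<in> lists {..<96}"
      using toeplitz_less by (auto simp: toeplitz_word_def)
    ultimately show "w \<in> {w \<in> lists {..<96}. \<not> occurs_in {..<96} \<phi> w}"
      using assms unfolding occurs_in_def by blast
  qed
  ultimately show ?thesis
    unfolding avoidable_def k_avoidable_def by (meson infinite_super)
qed

section \<open>Avoidability of the seven formulas\<close>

lemma sublist_appendD:
  assumes "sublist (u @ v) w"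
  shows "sublist u w" "sublist v w"
  using sublist_order.order_trans[OF _ assms] by simp_all

lemma avoidable_xx: "avoidable {[Var x, Var x]}"
proof (rule avoidable_if_toeplitz_word_avoids)
  fix f :: "'a pattern \<Rightarrow> nat list" and n
  assume f: "morphism f" "non_erasing f" "respects_reversal f"
    and occ: "\<forall>p\<in>{[Var x, Var x]}. sublist (f p) (toeplitz_word n)"
  \<comment> \<open>A square is a repetition with empty gap.\<close>
  have "sublist (f [Var x] @ [] @ f [Var x]) (toeplitz_word n)"
    using occ f(1) by (simp add: morphism_Cons[of f _ "_ # _"])
  then show False
    using f(2) toeplitz_word_repetition by (metis le0 list.size(3) non_erasing_def not_Cons_self2)
qed

text \<open>The centre of a nonempty even palindrome is a doubled letter, a pair equal to its own
  mirror image.\<close>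

lemma toeplitz_word_even_palindrome:
  assumes "sublist (u @ rev u) (toeplitz_word n)"
  shows "u = []"
proof (rule ccontr)
  assume "u \<noteq> []"
  then obtain r c where "u = r @ [c]" by (metis rev_exhaust)
  then have "sublist [c, c] (u @ rev u)" by (auto simp: sublist_def)
  then show False
    using assms toeplitz_word_mirror_pair sublist_order.order_trans by metis
qed

lemma avoidable_xxR: "avoidable {[Var x, Rev x]}"
proof (rule avoidable_if_toeplitz_word_avoids)
  fix f :: "'a pattern \<Rightarrow> nat list" and n
  assume f: "morphism f" "non_erasing f" "respects_reversal f"
    and occ: "\<forall>p\<in>{[Var x, Rev x]}. sublist (f p) (toeplitz_word n)"
  have "sublist (f [Var x] @ rev (f [Var x])) (toeplitz_word n)"
    using occ f(1,3) by (simp add: morphism_Cons[of f _ "_ # _"] respects_reversal_def)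
  then show False
    using f(2) toeplitz_word_even_palindrome by (metis list.distinct(1) non_erasing_def)
qed

text \<open>The shorter of the two images is the gap of a repetition in the fragment where the
  longer one surrounds it.\<close>

lemma avoidable_xyx_yxy: "avoidable {[Var x, Var y, Var x], [Var y, Var x, Var y]}"
proof (rule avoidable_if_toeplitz_word_avoids)
  fix f :: "'a pattern \<Rightarrow> nat list" and n
  assume f: "morphism f" "non_erasing f" "respects_reversal f"
    and occ: "\<forall>p\<in>{[Var x, Var y, Var x], [Var y, Var x, Var y]}.
      sublist (f p) (toeplitz_word n)"
  have "sublist (f [Var x] @ f [Var y] @ f [Var x]) (toeplitz_word n)"
    "sublist (f [Var y] @ f [Var x] @ f [Var y]) (toeplitz_word n)"
    using occ f(1) by (simp_all add: morphism_Cons[of f _ "_ # _"])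
  moreover have "f [Var x] \<noteq> []" "f [Var y] \<noteq> []" using f(2) by (auto simp: non_erasing_def)
  ultimately show False using toeplitz_word_repetition nat_le_linear by metis
qed

lemma toeplitz_word_mirror_single:
  assumes "sublist v (toeplitz_word n)" "sublist (rev v) (toeplitz_word n)" "v \<noteq> []"
  obtains c where "v = [c]"
  using toeplitz_word_mirror[OF assms(1,2)] assms(3)
  by (metis One_nat_def le_Suc_eq le_zero_eq length_0_conv length_Suc_conv)

text \<open>The image of \<open>y\<close> occurs with its mirror image, so it is a single letter.
  The last letter of the image of \<open>x\<close> precedes it in the first fragment and follows it
  in the second, where the image of \<open>x\<close> is reversed.\<close>

lemma avoidable_xy_yxR_yR: "avoidable {[Var x, Var y], [Var y, Rev x], [Rev y]}"
proof (rule avoidable_if_toeplitz_word_avoids)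
  fix f :: "'a pattern \<Rightarrow> nat list" and n
  assume f: "morphism f" "non_erasing f" "respects_reversal f"
    and occ: "\<forall>p\<in>{[Var x, Var y], [Var y, Rev x], [Rev y]}. sublist (f p) (toeplitz_word n)"
  have ne: "f [Var x] \<noteq> []" "f [Var y] \<noteq> []" using f(2) by (auto simp: non_erasing_def)
  have s: "sublist (f [Var x] @ f [Var y]) (toeplitz_word n)"
    "sublist (f [Var y] @ rev (f [Var x])) (toeplitz_word n)"
    "sublist (rev (f [Var y])) (toeplitz_word n)"
    using occ f(1,3) by (simp_all add: morphism_Cons[of f _ "_ # _"] respects_reversal_def)
  obtain b where b: "f [Var y] = [b]"
    using toeplitz_word_mirror_single s(3) sublist_appendD(2)[OF s(1)] ne(2) by blast
  obtain r c where c: "f [Var x] = r @ [c]" using ne(1) by (metis rev_exhaust)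
  have "sublist [c, b] (toeplitz_word n)" "sublist [b, c] (toeplitz_word n)"
    using s(1,2) sublist_appendD(2)[of r "[c, b]"] sublist_appendD(1)[of "[b, c]" "rev r"]
    by (simp_all add: b c)
  then show False by (rule toeplitz_word_mirror_pair)
qed

text \<open>Both images occur with their mirror images and so are single letters; the first two
  fragments then become mirror images of each other.\<close>

lemma avoidable_xy_yx_xR_yR: "avoidable {[Var x, Var y], [Var y, Var x], [Rev x], [Rev y]}"
proof (rule avoidable_if_toeplitz_word_avoids)
  fix f :: "'a pattern \<Rightarrow> nat list" and n
  assume f: "morphism f" "non_erasing f" "respects_reversal f"
    and occ: "\<forall>p\<in>{[Var x, Var y], [Var y, Var x], [Rev x], [Rev y]}.
      sublist (f p) (toeplitz_word n)"
  have ne: "f [Var x] \<noteq> []" "f [Var y] \<noteq> []" using f(2) by (auto simp: non_erasing_def)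
  have s: "sublist (f [Var x] @ f [Var y]) (toeplitz_word n)"
    "sublist (f [Var y] @ f [Var x]) (toeplitz_word n)"
    "sublist (rev (f [Var x])) (toeplitz_word n)" "sublist (rev (f [Var y])) (toeplitz_word n)"
    using occ f(1,3) by (simp_all add: morphism_Cons[of f _ "_ # _"] respects_reversal_def)
  obtain a b where "f [Var x] = [a]" "f [Var y] = [b]"
    using toeplitz_word_mirror_single s(3,4) sublist_appendD[OF s(1)] ne by metis
  then show False using s(1,2) toeplitz_word_mirror_pair by simp
qed

lemma avoidable_xy_yRxR: "avoidable {[Var x, Var y], [Rev y, Rev x]}"
proof (rule avoidable_if_toeplitz_word_avoids)
  fix f :: "'a pattern \<Rightarrow> nat list" and n
  assume f: "morphism f" "non_erasing f" "respects_reversal f"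
    and occ: "\<forall>p\<in>{[Var x, Var y], [Rev y, Rev x]}. sublist (f p) (toeplitz_word n)"
  have ne: "f [Var x] \<noteq> []" "f [Var y] \<noteq> []" using f(2) by (auto simp: non_erasing_def)
  have "sublist (f [Var x] @ f [Var y]) (toeplitz_word n)"
    "sublist (rev (f [Var x] @ f [Var y])) (toeplitz_word n)"
    using occ f(1,3) by (simp_all add: morphism_Cons[of f _ "_ # _"] respects_reversal_def)
  then show False
    using toeplitz_word_mirror_single ne by (metis append_is_Nil_conv append_eq_Cons_conv)
qed

text \<open>The image of \<open>y\<close> occurs with its mirror image, so it has one letter and is
  no longer than the image of \<open>x\<close>.\<close>

lemma avoidable_xyx_yR: "avoidable {[Var x, Var y, Var x], [Rev y]}"
proof (rule avoidable_if_toeplitz_word_avoids)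
  fix f :: "'a pattern \<Rightarrow> nat list" and n
  assume f: "morphism f" "non_erasing f" "respects_reversal f"
    and occ: "\<forall>p\<in>{[Var x, Var y, Var x], [Rev y]}. sublist (f p) (toeplitz_word n)"
  have ne: "f [Var x] \<noteq> []" using f(2) by (auto simp: non_erasing_def)
  have s: "sublist (f [Var x] @ f [Var y] @ f [Var x]) (toeplitz_word n)"
    "sublist (rev (f [Var y])) (toeplitz_word n)"
    using occ f(1,3) by (simp_all add: morphism_Cons[of f _ "_ # _"] respects_reversal_def)
  have "sublist (f [Var y]) (toeplitz_word n)"
    using s(1) sublist_appendD by blast
  then have "length (f [Var y]) \<le> length (f [Var x])"
    using toeplitz_word_mirror s(2) ne by (metis One_nat_def Suc_leI le_trans length_greater_0_conv)
  then show False using s(1) ne toeplitz_word_repetition by blast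
qed

section \<open>Unavoidable formulas\<close>

text \<open>A morphism is built from its values \<open>g\<close> on letters. When every word of
  length at least \<open>2 * k + 2\<close> admits one, the avoiding words have bounded length and
  are finitely many.\<close>

lemma not_avoidableI:
  fixes \<psi> :: "'v fragments"
  assumes "\<And>k w. w \<in> lists {..<k::nat} \<Longrightarrow> 2 * k + 2 \<le> length w \<Longrightarrow>
      \<exists>g. (\<forall>l. g l \<noteq> [] \<and> set (g l) \<subseteq> {..<k} \<and> g (mirror l) = rev (g l)) \<and>
          (\<forall>p\<in>\<psi>. sublist (concat (map g p)) w)"
  shows "\<not> avoidable \<psi>"
proof
  assume "avoidable \<psi>"
  then obtain k :: nat where k: "infinite {w \<in> lists {..<k}. \<not> occurs_in {..<k} \<psi> w}"
    unfolding avoidable_def k_avoidable_def by blast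
  have "occurs_in {..<k} \<psi> w" if w: "w \<in> lists {..<k}" "2 * k + 2 \<le> length w" for w
  proof -
    obtain g where g: "\<forall>l. g l \<noteq> [] \<and> set (g l) \<subseteq> {..<k} \<and> g (mirror l) = rev (g l)"
      "\<forall>p\<in>\<psi>. sublist (concat (map g p)) w"
      using assms[OF w] by blast
    have "respects_reversal (\<lambda>p. concat (map g p))"
      using g(1) by (simp add: respects_reversal_def flip: mirror.simps(1))
    moreover have "range (\<lambda>p. concat (map g p)) \<subseteq> lists {..<k}"
      using g(1) by fastforce
    ultimately show ?thesis
      using g morphism_concat_map[of g] non_erasing_concat_map[of g] unfolding occurs_in_def
      by (intro exI[of _ "\<lambda>p. concat (map g p)"]) simp
  qed
  then have "{w \<in> lists {..<k}. \<not> occurs_in {..<k} \<psi> w}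
      \<subseteq> {w. set w \<subseteq> {..<k} \<and> length w \<le> 2 * k + 2}"
    using nat_le_linear by auto
  then show False
    using k finite_lists_length_le[of "{..<k}"] finite_subset by blast
qed

text \<open>Pigeonhole on the \<open>k + 1\<close> even positions 0, 2, ..., \<open>2 * k\<close>:
  two of them carry the same letter and cannot be adjacent, so the gap is nonempty.\<close>

lemma ex_separated_repetition:
  assumes w: "w \<in> lists {..<k::nat}" "2 * k + 2 \<le> length w"
  obtains c u where "u \<noteq> []" "sublist (c # u @ [c]) w"
proof -
  have "(\<lambda>i. w ! (2 * i)) ` {..k} \<subseteq> {..<k}"
  proof (intro image_subsetI)
    fix i assume "i \<in> {..k}"
    then have "w ! (2 * i) \<in> set w" using w(2) by (intro nth_mem) auto
    then show "w ! (2 * i) \<in> {..<k}" using w(1) by blast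
  qed
  then have "card ((\<lambda>i. w ! (2 * i)) ` {..k}) \<le> k"
    using card_mono[of "{..<k}"] by fastforce
  then have "\<not> inj_on (\<lambda>i. w ! (2 * i)) {..k}"
    using pigeonhole[of "\<lambda>i. w ! (2 * i)" "{..k}"] by simp
  then obtain i j where ij: "i < j" "j \<le> k" "w ! (2 * i) = w ! (2 * j)"
    unfolding inj_on_def by (metis atMost_iff linorder_neqE_nat)
  define u where "u = take (2 * j - 2 * i - 1) (drop (Suc (2 * i)) w)"
  have "w = take (2 * i) w @ w ! (2 * i) # drop (Suc (2 * i)) w"
    by (rule id_take_nth_drop) (use ij w in simp)
  moreover have "drop (Suc (2 * i)) w = u @ drop (2 * j) w"
    using ij w append_take_drop_id[of "2 * j - 2 * i - 1" "drop (Suc (2 * i)) w"]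
    by (simp add: u_def)
  moreover have "drop (2 * j) w = w ! (2 * j) # drop (Suc (2 * j)) w"
    using ij w by (simp add: Cons_nth_drop_Suc)
  ultimately have "w = take (2 * i) w @ (w ! (2 * i) # u @ [w ! (2 * i)]) @ drop (Suc (2 * j)) w"
    using ij(3) by simp
  then have "sublist (w ! (2 * i) # u @ [w ! (2 * i)]) w"
    unfolding sublist_def by blast
  moreover have "u \<noteq> []" using ij w by (simp add: u_def)
  ultimately show ?thesis using that by blast
qed

text \<open>A single letter is a palindrome, so sending \<open>a\<close> to \<open>[e]\<close> hides
  the signs of the outer letters. The gap \<open>u\<close> may differ from its mirror image, which
  is why the middle letter has a fixed sign.\<close>

lemma not_avoidable_sandwich:
  assumes ab: "b \<noteq> a" "b \<noteq> mirror a"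
    and \<psi>: "\<And>p. p \<in> \<psi> \<Longrightarrow> \<exists>c\<in>{a, mirror a}. \<exists>d\<in>{a, mirror a}. sublist p [c, b, d]"
  shows "\<not> avoidable \<psi>"
proof (rule not_avoidableI)
  fix k and w :: "nat list"
  assume w: "w \<in> lists {..<k}" "2 * k + 2 \<le> length w"
  obtain e u where u: "u \<noteq> []" "sublist (e # u @ [e]) w"
    using ex_separated_repetition[OF w] by blast
  define g where "g l = (if l = b then u else if l = mirror b then rev u else [e])" for l
  have in_k: "e < k" "set u \<subseteq> {..<k}"
    using set_mono_sublist[OF u(2)] w(1) by auto
  have "sublist (concat (map g p)) w" if p: "p \<in> \<psi>" for p
  proof -
    obtain c d where "c \<in> {a, mirror a}" "d \<in> {a, mirror a}" and s: "sublist p [c, b, d]"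
      using \<psi>[OF p] by blast
    then have "g c = [e]" "g d = [e]" "g b = u"
      using ab by (auto simp: g_def mirror_eq_iff)
    then have "sublist (concat (map g p)) (e # u @ [e])"
      using sublist_concat_map[OF s, of g] by simp
    then show ?thesis using u(2) sublist_order.order_trans by blast
  qed
  moreover have "g l \<noteq> [] \<and> set (g l) \<subseteq> {..<k} \<and> g (mirror l) = rev (g l)" for l
    using in_k u(1) by (auto simp: g_def mirror_eq_iff)
  ultimately show "\<exists>g. (\<forall>l. g l \<noteq> [] \<and> set (g l) \<subseteq> {..<k} \<and> g (mirror l) = rev (g l)) \<and>
          (\<forall>p\<in>\<psi>. sublist (concat (map g p)) w)"
    by blast
qed

text \<open>When every variable goes to a single letter all signs disappear, and two consecutive
  letters of the word suffice.\<close>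

lemma not_avoidable_pair:
  assumes ab: "b \<noteq> a" "b \<noteq> mirror a"
    and \<psi>: "\<And>p. p \<in> \<psi> \<Longrightarrow> \<exists>c\<in>{a, mirror a}. \<exists>d\<in>{b, mirror b}. sublist p [c, d]"
  shows "\<not> avoidable \<psi>"
proof (rule not_avoidableI)
  fix k and w :: "nat list"
  assume w: "w \<in> lists {..<k}" "2 * k + 2 \<le> length w"
  then obtain e f r where r: "w = e # f # r"
    by (metis add_2_eq_Suc' Suc_le_length_iff)
  define g where "g l = (if l \<in> {b, mirror b} then [f] else [e])" for l
  have "sublist (concat (map g p)) w" if p: "p \<in> \<psi>" for p
  proof -
    obtain c d where "c \<in> {a, mirror a}" "d \<in> {b, mirror b}" and s: "sublist p [c, d]"
      using \<psi>[OF p] by blast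
    then have "g c = [e]" "g d = [f]"
      using ab by (auto simp: g_def mirror_eq_iff)
    then have "sublist (concat (map g p)) [e, f]"
      using sublist_concat_map[OF s, of g] by simp
    moreover have "sublist [e, f] w" by (simp add: r)
    ultimately show ?thesis using sublist_order.order_trans by blast
  qed
  moreover have "g l \<noteq> [] \<and> set (g l) \<subseteq> {..<k} \<and> g (mirror l) = rev (g l)" for l
    using w(1) r by (auto simp: g_def mirror_eq_iff)
  ultimately show "\<exists>g. (\<forall>l. g l \<noteq> [] \<and> set (g l) \<subseteq> {..<k} \<and> g (mirror l) = rev (g l)) \<and>
          (\<forall>p\<in>\<psi>. sublist (concat (map g p)) w)"
    by blast
qed

section \<open>Divisibility of two-variable formulas\<close>

fun signed_subst :: "'v letter \<Rightarrow> 'v letter \<Rightarrow> var2 letter \<Rightarrow> 'v letter" where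
  "signed_subst a b (Var X) = a"
| "signed_subst a b (Var Y) = b"
| "signed_subst a b (Rev X) = mirror a"
| "signed_subst a b (Rev Y) = mirror b"

lemma UNIV_var2: "(UNIV :: var2 set) = {X, Y}"
  using var2.exhaust by auto

lemma UNIV_letter_var2: "(UNIV :: var2 letter set) = {Var X, Var Y, Rev X, Rev Y}"
proof -
  have "l \<in> {Var X, Var Y, Rev X, Rev Y}" for l :: "var2 letter"
    using UNIV_var2 by (cases l) auto
  then show ?thesis by blast
qed

lemma ex_letter_var2:
  "(\<exists>a. P a) \<longleftrightarrow> P (Var X) \<or> P (Var Y) \<or> P (Rev X) \<or> P (Rev Y)" for P :: "var2 letter \<Rightarrow> bool"
proof -
  have "(\<exists>a. P a) \<longleftrightarrow> (\<exists>a\<in>{Var X, Var Y, Rev X, Rev Y}. P a)"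
    by (simp only: flip: UNIV_letter_var2) simp
  then show ?thesis by simp
qed

text \<open>A dividing morphism is determined by the images \<open>a\<close>, \<open>b\<close> of
  the two variables, and it is injective exactly when these belong to different variables.
  Divisibility becomes a search over pairs of letters.\<close>

lemma e_divides_var2_iff:
  fixes \<phi> \<psi> :: "var2 fragments"
  shows "e_divides \<phi> \<psi> \<longleftrightarrow>
    (\<exists>a b. b \<noteq> a \<and> b \<noteq> mirror a \<and> (\<forall>p\<in>\<phi>. factor_of (map (signed_subst a b) p) \<psi>))"
proof
  assume "e_divides \<phi> \<psi>"
  then obtain h where h: "morphism h" "inj h" "respects_d_reversal h"
    "\<forall>a. length (h [a]) = 1" "\<forall>p\<in>\<phi>. factor_of (h p) \<psi>"
    by (auto simp: e_divides_def)
  obtain a b where ab: "h [Var X] = [a]" "h [Var Y] = [b]"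
    using h(4) by (metis One_nat_def length_0_conv length_Suc_conv)
  have rev_ab: "h [Rev X] = [mirror a]" "h [Rev Y] = [mirror b]"
    using h(3) ab by (simp_all add: respects_d_reversal_def)
  have single: "h [l] = [signed_subst a b l]" for l
    using ab rev_ab by (cases "(a, b, l)" rule: signed_subst.cases) auto
  have "h p = map (signed_subst a b) p" for p
  proof (induction p)
    case (Cons l p)
    then show ?case using morphism_Cons[OF h(1), of l p] single by simp
  qed (simp add: morphism_Nil h(1))
  moreover have "b \<noteq> a" "b \<noteq> mirror a"
    using injD[OF h(2), of "[Var X]" "[Var Y]"] injD[OF h(2), of "[Rev X]" "[Var Y]"] ab rev_ab
    by auto
  ultimately show "\<exists>a b. b \<noteq> a \<and> b \<noteq> mirror a \<and>
      (\<forall>p\<in>\<phi>. factor_of (map (signed_subst a b) p) \<psi>)"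
    using h(5) by auto
next
  assume "\<exists>a b. b \<noteq> a \<and> b \<noteq> mirror a \<and> (\<forall>p\<in>\<phi>. factor_of (map (signed_subst a b) p) \<psi>)"
  then obtain a b where ab: "b \<noteq> a" "b \<noteq> mirror a"
    and *: "\<forall>p\<in>\<phi>. factor_of (map (signed_subst a b) p) \<psi>"
    by blast
  have "inj (signed_subst a b)"
  proof (rule injI)
    fix l m assume "signed_subst a b l = signed_subst a b m"
    then show "l = m"
      using ab by (cases "(a, b, l)" rule: signed_subst.cases;
        cases "(a, b, m)" rule: signed_subst.cases) (auto simp: mirror_eq_iff)
  qed
  then have "inj (map (signed_subst a b))" by simp
  moreover have "signed_subst a b (Rev x) = mirror (signed_subst a b (Var x))" for x
    by (cases x) simp_all
  ultimately show "e_divides \<phi> \<psi>"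
    using * unfolding e_divides_def
    by (intro exI[of _ "map (signed_subst a b)"])
      (simp add: morphism_def respects_d_reversal_def)
qed

lemma letter_var2_cases:
  fixes a b l :: "var2 letter"
  assumes "b \<noteq> a" "b \<noteq> mirror a"
  shows "l \<in> {a, mirror a, b, mirror b}"
proof -
  have "{a, b, l} \<subseteq> {Var X, Var Y, Rev X, Rev Y}" using UNIV_letter_var2 by blast
  then show ?thesis using assms by auto
qed

section \<open>The basis and the formulas that it does not divide\<close>

definition basis2 :: "var2 fragments set" where
  "basis2 =
     {{[Var X, Var X]},
      {[Var X, Rev X]},
      {[Var X, Var Y, Var X], [Var Y, Var X, Var Y]},
      {[Var X, Var Y], [Var Y, Var X], [Rev X], [Rev Y]},
      {[Var X, Var Y], [Var Y, Rev X], [Rev Y]},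
      {[Var X, Var Y], [Rev Y, Rev X]},
      {[Var X, Var Y, Var X], [Rev Y]}}"

text \<open>The outcomes are the hypotheses of \<open>not_avoidable_sandwich\<close> and
  \<open>not_avoidable_pair\<close>. The split is on whether a factor of length 3 exists and, if
  none does, on whether all four letters occur.\<close>

lemma undivided_cases:
  fixes \<psi> :: "var2 fragments"
  assumes undiv: "\<And>\<phi>. \<phi> \<in> basis2 \<Longrightarrow> \<not> e_divides \<phi> \<psi>"
  obtains (sandwich) a b where "b \<noteq> a" "b \<noteq> mirror a"
      "\<And>p. p \<in> \<psi> \<Longrightarrow> \<exists>c\<in>{a, mirror a}. \<exists>d\<in>{a, mirror a}. sublist p [c, b, d]"
    | (pair) a b where "b \<noteq> a" "b \<noteq> mirror a"
      "\<And>p. p \<in> \<psi> \<Longrightarrow> \<exists>c\<in>{a, mirror a}. \<exists>d\<in>{b, mirror b}. sublist p [c, d]"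
proof -
  define F where "F p \<longleftrightarrow> factor_of p \<psi>" for p
  have F_sub: "F p" if "F q" "sublist p q" for p q
    using that sublist_order.order_trans unfolding F_def factor_of_def by blast
  have undiv': "\<not> (\<forall>p\<in>\<phi>. F (map (signed_subst a b) p))"
    if "\<phi> \<in> basis2" "b \<noteq> a" "b \<noteq> mirror a" for \<phi> a b
    using undiv[OF that(1)] that(2,3) unfolding e_divides_var2_iff F_def by blast
  have ex_other: "\<exists>b. b \<noteq> a \<and> b \<noteq> mirror a" for a :: "var2 letter"
    using UNIV_letter_var2 by (cases a) (auto simp: ex_letter_var2)
  \<comment> \<open>Each basis formula is now excluded under all signed renamings; \<open>a\<close>
    and \<open>b\<close> may themselves be reversed variables.\<close>
  have no_xx: "\<not> F [a, a]" and no_xxR: "\<not> F [a, mirror a]" for a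
    using ex_other[of a] undiv'[of "{[Var X, Var X]}" _ a] undiv'[of "{[Var X, Rev X]}" _ a]
    by (auto simp: basis2_def)
  have no_xyx_yxy: "\<not> (F [a, b, a] \<and> F [b, a, b])" if "b \<noteq> a" "b \<noteq> mirror a" for a b
    using undiv'[OF _ that, of "{[Var X, Var Y, Var X], [Var Y, Var X, Var Y]}"]
    by (simp add: basis2_def)
  have no_xy_yx: "\<not> (F [a, b] \<and> F [b, a] \<and> F [mirror a] \<and> F [mirror b])"
    if "b \<noteq> a" "b \<noteq> mirror a" for a b
    using undiv'[OF _ that, of "{[Var X, Var Y], [Var Y, Var X], [Rev X], [Rev Y]}"]
    by (simp add: basis2_def)
  have no_xy_yxR: "\<not> (F [a, b] \<and> F [b, mirror a] \<and> F [mirror b])"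
    if "b \<noteq> a" "b \<noteq> mirror a" for a b
    using undiv'[OF _ that, of "{[Var X, Var Y], [Var Y, Rev X], [Rev Y]}"]
    by (simp add: basis2_def)
  have no_xy_yRxR: "\<not> (F [a, b] \<and> F [mirror b, mirror a])" if "b \<noteq> a" "b \<noteq> mirror a" for a b
    using undiv'[OF _ that, of "{[Var X, Var Y], [Rev Y, Rev X]}"] by (simp add: basis2_def)
  have no_xyx_yR: "\<not> (F [a, b, a] \<and> F [mirror b])" if "b \<noteq> a" "b \<noteq> mirror a" for a b
    using undiv'[OF _ that, of "{[Var X, Var Y, Var X], [Rev Y]}"] by (simp add: basis2_def)
  have alternating: "b \<noteq> a \<and> b \<noteq> mirror a" if "F [a, b]" for a b
    using that no_xx no_xxR by auto
  have in_F: "F p" if "p \<in> \<psi>" for p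
    using that by (auto simp: F_def factor_of_def)
  have F2: "F [l, m]" if "F (l # m # r)" for l m r
    using F_sub[OF that] by simp
  have F1: "F [l]" if "F (l # r)" for l r
    using F_sub[OF that] by simp
  have F_tl: "F r" if "F (l # r)" for l r
    using F_sub[OF that] by (simp add: sublist_Cons_right)
  show thesis
  proof (cases "\<exists>c b d. F [c, b, d]")
    case True
    then obtain c b d where cbd: "F [c, b, d]" by blast
    have bc: "b \<noteq> c" "b \<noteq> mirror c" using alternating F2[OF cbd] by auto
    have bd: "d \<noteq> b" "d \<noteq> mirror b" using alternating F_tl[OF cbd] by auto
    have d: "d \<in> {c, mirror c}" using letter_var2_cases[OF bc, of d] bd by auto
    \<comment> \<open>Together with \<open>mirror b\<close>, the factor \<open>cbd\<close> would
      give xyx \<cdot> y^R if \<open>d = c\<close>, and xy \<cdot> y x^R \<cdot> y^R if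
      \<open>d = mirror c\<close>.\<close>
    have no_bR: "\<not> F [mirror b]"
      using d cbd no_xyx_yR[OF bc] no_xy_yxR[OF bc] F2[OF cbd] F_tl[OF cbd] by auto
    \<comment> \<open>Otherwise the factor is \<open>bmb\<close> with \<open>m\<close> over the
      variable of \<open>c\<close>. It excludes \<open>mirror m\<close>, so \<open>c\<close> and
      \<open>d\<close> both equal \<open>m\<close>, and xyx \<cdot> yxy arises.\<close>
    have middle: "m = b" if lmn: "F [l, m, n]" for l m n
    proof (rule ccontr)
      assume "m \<noteq> b"
      have *: "F [l]" "F [m]" "F [n]" "F [l, m]" "F [m, n]"
        using F_sub[OF lmn] by (auto simp: sublist_Cons_right)
      have lm: "m \<noteq> l" "m \<noteq> mirror l" "n \<noteq> m" "n \<noteq> mirror m"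
        using * alternating by auto
      have m: "m \<in> {c, mirror c}"
        using \<open>m \<noteq> b\<close> letter_var2_cases[OF bc, of m] no_bR * by auto
      have ln: "l = b" "n = b"
        using letter_var2_cases[OF bc, of l] letter_var2_cases[OF bc, of n] no_bR * lm m
        by auto
      have "\<not> F [mirror m]" using no_xyx_yR[of m b] lmn ln lm by auto
      moreover have "F [c]" "F [d]" using F_sub[OF cbd] by (auto simp: sublist_Cons_right)
      ultimately have "c = m" "d = m" using m d by auto
      then show False using no_xyx_yxy[OF bc] cbd lmn ln by simp
    qed
    show thesis
    proof (rule sandwich[OF bc])
      fix p assume "p \<in> \<psi>"
      then have p: "F p" by (rule in_F)
      have letter: "l \<in> {c, mirror c, b}" if "F [l]" for l
        using letter_var2_cases[OF bc, of l] that no_bR by auto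
      consider "p = []" | l where "p = [l]" | l m where "p = [l, m]" | l m n where "p = [l, m, n]"
        | l m n q r where "p = l # m # n # q # r"
        by (metis list.exhaust)
      then show "\<exists>c'\<in>{c, mirror c}. \<exists>d\<in>{c, mirror c}. sublist p [c', b, d]"
      proof cases
        case 1
        then show ?thesis by auto
      next
        case (2 l)
        then show ?thesis using p letter[of l] by (auto simp: sublist_Cons_right)
      next
        case (3 l m)
        then have "l \<in> {c, mirror c, b}" "m \<in> {c, mirror c, b}" "m \<noteq> l" "m \<noteq> mirror l"
          using p letter F1 F_tl alternating by blast+
        then show ?thesis using 3 by (auto simp: sublist_Cons_right)
      next
        case (4 l m n)
        then have "F [l]" "F [n]" "F [l, m]" "F [m, n]"
          using F_sub[OF p] by (auto simp: sublist_Cons_right)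
        then have "m = b" "l \<in> {c, mirror c, b}" "n \<in> {c, mirror c, b}" "m \<noteq> l" "n \<noteq> m"
          using p 4 letter[of l] letter[of n] alternating[of l m] alternating[of m n] middle
          by auto
        then show ?thesis using 4 by (auto simp: sublist_Cons_right)
      next
        case (5 l m n q r)
        \<comment> \<open>In a factor of length 4 both inner letters would be \<open>b\<close>,
          against alternation.\<close>
        have "F [l, m, n]" "F [m, n, q]" "F [m, n]"
          using F_sub[OF p] 5 by (auto simp: sublist_Cons_right)
        then show ?thesis
          using middle[of l m n] middle[of m n q] alternating[of m n] by simp
      qed
    qed
  next
    case False
    have short: "p = [] \<or> (\<exists>l. p = [l]) \<or> (\<exists>l m. p = [l, m])" if "F p" for p
    proof (rule ccontr)
      assume "\<not> ?thesis"
      then obtain l m n r where "p = l # m # n # r" by (metis list.exhaust)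
      then have "F [l, m, n]" using F_sub[OF that] by simp
      then show False using False by blast
    qed
    show thesis
    proof (cases "\<forall>l. F [l]")
      case all: True
      show thesis
      proof (cases "\<exists>a b. F [a, b]")
        case True
        then obtain a b where ab: "F [a, b]" by blast
        have ba: "b \<noteq> a" "b \<noteq> mirror a" using alternating[OF ab] by auto
        show thesis
        proof (rule pair[OF ba])
          fix p assume "p \<in> \<psi>"
          then have p: "F p" by (rule in_F)
          have "l \<in> {a, mirror a} \<and> m \<in> {b, mirror b}" if lm: "F [l, m]" for l m
          proof -
            \<comment> \<open>All letters occur, so next to \<open>ab\<close> each pair in the
              opposite order completes a basis formula.\<close>
            have "\<not> F [b, a]" "\<not> F [b, mirror a]" "\<not> F [mirror b, mirror a]"
              using all ab no_xy_yx[OF ba] no_xy_yxR[OF ba] no_xy_yRxR[OF ba] by auto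
            \<comment> \<open>Here the roles change: with \<open>mirror b\<close> as x and
              \<open>a\<close> as y, the pairs \<open>[mirror b, a]\<close> and
              \<open>[a, b]\<close> are xy and y x^R.\<close>
            moreover have "\<not> F [mirror b, a]"
              using all ab no_xy_yxR[of a "mirror b"] ba(1) not_sym[OF ba(2)]
              by (auto simp: mirror_eq_iff)
            ultimately show ?thesis
              using lm alternating[OF lm] letter_var2_cases[OF ba, of l]
                letter_var2_cases[OF ba, of m] by auto
          qed
          then show "\<exists>c\<in>{a, mirror a}. \<exists>d\<in>{b, mirror b}. sublist p [c, d]"
            using short[OF p] p letter_var2_cases[OF ba] by (fastforce simp: sublist_Cons_right)
        qed
      next
        case no_pair: False
        show thesis
        proof (rule pair[of "Var Y" "Var X"])
          fix p assume "p \<in> \<psi>"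
          then have "F p" by (rule in_F)
          then have "p = [] \<or> (\<exists>l. p = [l])" using short no_pair by blast
          then show "\<exists>c\<in>{Var X, mirror (Var X)}. \<exists>d\<in>{Var Y, mirror (Var Y)}. sublist p [c, d]"
            using letter_var2_cases[of "Var Y" "Var X"] by (fastforce simp: sublist_Cons_right)
        qed simp_all
      qed
    next
      case some: False
      then obtain l where "\<not> F [l]" by blast
      \<comment> \<open>The mirror image of \<open>b\<close> is missing from the formula, so
        \<open>b\<close> can be the middle letter of fixed sign.\<close>
      define b where "b = mirror l"
      have no_bR: "\<not> F [mirror b]" using \<open>\<not> F [l]\<close> by (simp add: b_def)
      obtain a where "a \<noteq> b" "a \<noteq> mirror b" using ex_other by blast
      then have ba: "b \<noteq> a" "b \<noteq> mirror a" by (auto simp: mirror_eq_iff)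
      show thesis
      proof (rule sandwich[OF ba])
        fix p assume "p \<in> \<psi>"
        then have p: "F p" by (rule in_F)
        have letter: "l \<in> {a, mirror a, b}" if "F [l]" for l
          using letter_var2_cases[OF ba, of l] that no_bR by auto
        consider "p = []" | l where "p = [l]" | l m where "p = [l, m]"
          using short[OF p] by blast
        then show "\<exists>c\<in>{a, mirror a}. \<exists>d\<in>{a, mirror a}. sublist p [c, b, d]"
        proof cases
          case 1
          then show ?thesis by auto
        next
          case (2 l)
          then show ?thesis using p letter[of l] by (auto simp: sublist_Cons_right)
        next
          case (3 l m)
          then have "l \<in> {a, mirror a, b}" "m \<in> {a, mirror a, b}" "m \<noteq> l" "m \<noteq> mirror l"
            using p letter F1 F_tl alternating by blast+
          then show ?thesis using 3 by (auto simp: sublist_Cons_right)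
        qed
      qed
    qed
  qed
qed

text \<open>A finite check: for each pair of basis formulas, all choices of the two image letters
  are tried.\<close>

lemma basis2_irredundant:
  assumes "\<phi> \<in> basis2" "\<psi> \<in> basis2" "e_divides \<phi> \<psi>"
  shows "\<phi> = \<psi>"
  using assms unfolding basis2_def insert_iff empty_iff e_divides_var2_iff ex_letter_var2
  by (elim disjE) (simp_all add: factor_of_def sublist_Cons_right)

theorem theorem4p1:
  "avoidance_basis 2
     ({ {[Var X, Var X]},
        {[Var X, Rev X]},
        {[Var X, Var Y, Var X], [Var Y, Var X, Var Y]},
        {[Var X, Var Y], [Var Y, Var X], [Rev X], [Rev Y]},
        {[Var X, Var Y], [Var Y, Rev X], [Rev Y]},
        {[Var X, Var Y], [Rev Y, Rev X]},
        {[Var X, Var Y, Var X], [Rev Y]} } :: var2 fragments set)"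
proof -
  have "formula \<phi> \<and> avoidable \<phi>" if "\<phi> \<in> basis2" for \<phi>
    using that avoidable_xx[of X] avoidable_xxR[of X] avoidable_xyx_yxy[of X Y]
      avoidable_xy_yx_xR_yR[of X Y] avoidable_xy_yxR_yR[of X Y] avoidable_xy_yRxR[of X Y]
      avoidable_xyx_yR[of X Y]
    unfolding basis2_def formula_def insert_iff empty_iff by (elim disjE) simp_all
  moreover have "\<exists>\<phi>\<in>basis2. e_divides \<phi> \<psi>" if "avoidable \<psi>" for \<psi>
  proof (rule ccontr)
    assume "\<not> ?thesis"
    then have "\<not> e_divides \<phi> \<psi>" if "\<phi> \<in> basis2" for \<phi> using that by blast
    then show False
    proof (rule undivided_cases)
      fix a b :: "var2 letter"
      assume ab: "b \<noteq> a" "b \<noteq> mirror a"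
      show False if "\<And>p. p \<in> \<psi> \<Longrightarrow> \<exists>c\<in>{a, mirror a}. \<exists>d\<in>{a, mirror a}. sublist p [c, b, d]"
        using not_avoidable_sandwich[OF ab that] \<open>avoidable \<psi>\<close> by simp
      show False if "\<And>p. p \<in> \<psi> \<Longrightarrow> \<exists>c\<in>{a, mirror a}. \<exists>d\<in>{b, mirror b}. sublist p [c, d]"
        using not_avoidable_pair[OF ab that] \<open>avoidable \<psi>\<close> by simp
    qed
  qed
  ultimately have "avoidance_basis 2 basis2"
    using basis2_irredundant by (simp add: avoidance_basis_def UNIV_var2)
  then show ?thesis by (simp only: basis2_def)
qed

end
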